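(* Let $R$ be a right or left perfect ring with center $C$. Then the following conditions are equivalent. 1) $R$ is a centrally essential ring. 2) $\mathrm{Soc}(R_C)\subseteq C$ and all idempotents of the ring $R$ are central.
   Context: All rings are associative and unital (not necessarily commutative). $J(R)$ denotes the Jacobson radical of $R$. A ring $R$ with center $C$ is *centrally essential* if the module $R_C$ ($R$ regarded as a module over its center $C$) is an essential extension of $C_C$, i.e. every nonzero $C$-submodule of $R$ meets $C$ nontrivially; equivalently, for every $r\in R\setminus\{0\}$ there exists $c\in C$ with $rc\in C\setminus\{0\}$. A ring $R$ is *semiperfect* if $R/J(R)$ is an Artinian ring and every complete system of orthogonal idempotents of $R/J(R)$ can be lifted to a complete system of orthogonal idempotents of $R$. A ring $R$ is *left perfect* if $R$ is semiperfect and $J(R)$ is left $T$-nilpotent, i.e. for any sequence $x_1,x_2,\ldots$ of elements of $J(R)$ there exists $n$ such that $x_1x_2\cdots x_n=0$. *Right perfect* rings are defined similarly, with $J(R)$ right $T$-nilpotent, i.e. for any such sequence there exists $n$ with $x_n\cdots x_2x_1=0$. For a module $M$, the socle $\mathrm{Soc}(M)$ is the sum of all simple submodules of $M$, and $\mathrm{Soc}(M)=0$ if $M$ has no simple submodules. $\mathrm{Soc}(R_C)$ is the socle of $R$ regarded as a $C$-module. *)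

theory Defs
  imports "HOL-Algebra.Algebra"
begin

section \<open>The center, and the ring as a module over it\<close>

definition center :: "('a, 'b) ring_scheme \<Rightarrow> 'a set" where
  "center R = {c \<in> carrier R. \<forall>x \<in> carrier R. c \<otimes>\<^bsub>R\<^esub> x = x \<otimes>\<^bsub>R\<^esub> c}"

definition center_ring :: "('a, 'b) ring_scheme \<Rightarrow> ('a, 'b) ring_scheme" where
  "center_ring R = R\<lparr>carrier := center R\<rparr>"

definition center_module :: "('a, 'b) ring_scheme \<Rightarrow> ('a, 'a) module" where
  "center_module R =
     \<lparr>carrier = carrier R, monoid.mult = (\<otimes>\<^bsub>R\<^esub>), one = \<one>\<^bsub>R\<^esub>, ring.zero = \<zero>\<^bsub>R\<^esub>, add = (\<oplus>\<^bsub>R\<^esub>),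
      smult = (\<lambda>c r. r \<otimes>\<^bsub>R\<^esub> c)\<rparr>"

lemma (in ring) subcring_center: "subcring (center R) R"
proof (rule subcringI, rule subringI)
  fix a b assume ab: "a \<in> center R" "b \<in> center R"
  then have c: "a \<in> carrier R" "b \<in> carrier R"
    and comm: "\<And>x. x \<in> carrier R \<Longrightarrow> a \<otimes> x = x \<otimes> a" "\<And>x. x \<in> carrier R \<Longrightarrow> b \<otimes> x = x \<otimes> b"
    by (auto simp: center_def)
  show "\<ominus> a \<in> center R" using c comm(1) by (simp add: center_def l_minus r_minus)
  have "a \<otimes> b \<otimes> x = x \<otimes> (a \<otimes> b)" if x: "x \<in> carrier R" for x
  proof -
    have "a \<otimes> b \<otimes> x = a \<otimes> x \<otimes> b" using x c comm(2)[OF x] by (simp add: m_assoc)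
    also have "\<dots> = x \<otimes> (a \<otimes> b)" using x c comm(1)[OF x] by (simp add: m_assoc)
    finally show ?thesis .
  qed
  then show "a \<otimes> b \<in> center R" using c by (simp add: center_def)
  show "a \<oplus> b \<in> center R" using c comm by (simp add: center_def l_distr r_distr)
  show "a \<otimes> b = b \<otimes> a" using c comm(1) by blast
qed (auto simp: center_def)

lemma (in ring) cring_center_ring: "cring (center_ring R)"
  using subcring_center subcring_iff[of "center R"] by (auto simp: center_ring_def center_def)

lemma (in ring) module_center_module: "Module.module (center_ring R) (center_module R)"
proof (rule moduleI[OF cring_center_ring])
  show "abelian_group (center_module R)"
  proof (rule abelian_groupI)
    fix x assume "x \<in> carrier (center_module R)"
    then show "\<exists>y \<in> carrier (center_module R). y \<oplus>\<^bsub>center_module R\<^esub> x = \<zero>\<^bsub>center_module R\<^esub>"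
      by (intro bexI[of _ "\<ominus> x"]) (simp_all add: center_module_def l_neg)
  qed (simp_all add: center_module_def a_ac)
next
  fix a b x
  assume a: "a \<in> carrier (center_ring R)" and b: "b \<in> carrier (center_ring R)"
    and x: "x \<in> carrier (center_module R)"
  have c: "a \<in> carrier R" "b \<in> carrier R" "x \<in> carrier R"
    using a b x by (simp_all add: center_ring_def center_module_def center_def)
  have "a \<otimes> b = b \<otimes> a" using a c(2) by (simp add: center_ring_def center_def)
  then show "(a \<otimes>\<^bsub>center_ring R\<^esub> b) \<odot>\<^bsub>center_module R\<^esub> x =
      a \<odot>\<^bsub>center_module R\<^esub> (b \<odot>\<^bsub>center_module R\<^esub> x)"
    using c by (simp add: center_ring_def center_module_def m_assoc)
qed (simp_all add: center_module_def center_ring_def center_def r_distr l_distr)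

lemma (in ring) submodule_center: "submodule (center R) (center_ring R) (center_module R)"
proof -
  interpret M: Module.module "center_ring R" "center_module R"
    by (rule module_center_module)
  note C = subcringE[OF subcring_center]
  show ?thesis
  proof (rule M.submoduleI)
    show "center R \<subseteq> carrier (center_module R)"
      using C(1) by (simp add: center_module_def)
    show "\<zero>\<^bsub>center_module R\<^esub> \<in> center R"
      using C(2) by (simp add: center_module_def)
    show "\<ominus>\<^bsub>center_module R\<^esub> a \<in> center R" if "a \<in> center R" for a
      using C(5)[OF that] by (simp add: a_inv_def m_inv_def center_module_def)
    show "a \<oplus>\<^bsub>center_module R\<^esub> b \<in> center R" if "a \<in> center R" "b \<in> center R" for a b
      using C(7)[OF that] by (simp add: center_module_def)
    show "c \<odot>\<^bsub>center_module R\<^esub> a \<in> center R" if "c \<in> carrier (center_ring R)" "a \<in> center R" for c a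
      using C(6)[of a c] that by (simp add: center_module_def center_ring_def)
  qed
qed


section \<open>Essential extensions and socles of modules\<close>

definition essential_submodule :: "'b set \<Rightarrow> ('a, 'c) ring_scheme \<Rightarrow> ('a, 'b, 'd) module_scheme \<Rightarrow> bool"
  where "essential_submodule N A M \<longleftrightarrow>
    submodule N A M \<and>
    (\<forall>L. submodule L A M \<and> L \<noteq> {\<zero>\<^bsub>M\<^esub>} \<longrightarrow> L \<inter> N \<noteq> {\<zero>\<^bsub>M\<^esub>})"

definition simple_submodule :: "'b set \<Rightarrow> ('a, 'c) ring_scheme \<Rightarrow> ('a, 'b, 'd) module_scheme \<Rightarrow> bool"
  where "simple_submodule S A M \<longleftrightarrow>
    submodule S A M \<and> S \<noteq> {\<zero>\<^bsub>M\<^esub>} \<and>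
    (\<forall>L. submodule L A M \<and> L \<subseteq> S \<longrightarrow> L = {\<zero>\<^bsub>M\<^esub>} \<or> L = S)"

text \<open>The empty family contributes the zero element, so the socle is the zero submodule
  when there are no simple submodules.\<close>

definition socle :: "('a, 'c) ring_scheme \<Rightarrow> ('a, 'b, 'd) module_scheme \<Rightarrow> 'b set" where
  "socle A M =
     {finsum M f F | f F. finite F \<and> (\<forall>S \<in> F. simple_submodule S A M \<and> f S \<in> S)}"

definition centrally_essential :: "('a, 'b) ring_scheme \<Rightarrow> bool" where
  "centrally_essential R \<longleftrightarrow> essential_submodule (center R) (center_ring R) (center_module R)"


section \<open>Perfect rings\<close>

definition left_ideal :: "'a set \<Rightarrow> ('a, 'b) ring_scheme \<Rightarrow> bool" where
  "left_ideal I R \<longleftrightarrow>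
     additive_subgroup I R \<and> (\<forall>a \<in> I. \<forall>x \<in> carrier R. x \<otimes>\<^bsub>R\<^esub> a \<in> I)"

definition right_ideal :: "'a set \<Rightarrow> ('a, 'b) ring_scheme \<Rightarrow> bool" where
  "right_ideal I R \<longleftrightarrow>
     additive_subgroup I R \<and> (\<forall>a \<in> I. \<forall>x \<in> carrier R. a \<otimes>\<^bsub>R\<^esub> x \<in> I)"

definition maximal_right_ideal :: "'a set \<Rightarrow> ('a, 'b) ring_scheme \<Rightarrow> bool" where
  "maximal_right_ideal I R \<longleftrightarrow>
     right_ideal I R \<and> I \<noteq> carrier R \<and>
     (\<forall>K. right_ideal K R \<and> I \<subseteq> K \<longrightarrow> K = I \<or> K = carrier R)"

text \<open>Intersecting inside the carrier makes the radical of the zero ring the whole ring.\<close>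

definition jacobson_radical :: "('a, 'b) ring_scheme \<Rightarrow> 'a set" where
  "jacobson_radical R = {x \<in> carrier R. \<forall>I. maximal_right_ideal I R \<longrightarrow> x \<in> I}"

definition left_artinian :: "('a, 'b) ring_scheme \<Rightarrow> bool" where
  "left_artinian R \<longleftrightarrow>
     (\<forall>I :: nat \<Rightarrow> 'a set. (\<forall>n. left_ideal (I n) R) \<and> decseq I \<longrightarrow> (\<exists>n. \<forall>m \<ge> n. I m = I n))"

definition right_artinian :: "('a, 'b) ring_scheme \<Rightarrow> bool" where
  "right_artinian R \<longleftrightarrow>
     (\<forall>I :: nat \<Rightarrow> 'a set. (\<forall>n. right_ideal (I n) R) \<and> decseq I \<longrightarrow> (\<exists>n. \<forall>m \<ge> n. I m = I n))"

definition artinian :: "('a, 'b) ring_scheme \<Rightarrow> bool" where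
  "artinian R \<longleftrightarrow> left_artinian R \<and> right_artinian R"

definition complete_orthogonal_idempotents ::
    "('a, 'b) ring_scheme \<Rightarrow> nat \<Rightarrow> (nat \<Rightarrow> 'a) \<Rightarrow> bool" where
  "complete_orthogonal_idempotents R n e \<longleftrightarrow>
     (\<forall>i < n. e i \<in> carrier R \<and> e i \<otimes>\<^bsub>R\<^esub> e i = e i) \<and>
     (\<forall>i < n. \<forall>j < n. i \<noteq> j \<longrightarrow> e i \<otimes>\<^bsub>R\<^esub> e j = \<zero>\<^bsub>R\<^esub>) \<and>
     finsum R e {..<n} = \<one>\<^bsub>R\<^esub>"

definition semiperfect :: "('a, 'b) ring_scheme \<Rightarrow> bool" where
  "semiperfect R \<longleftrightarrow>
     artinian (R Quot jacobson_radical R) \<and>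
     (\<forall>n e. complete_orthogonal_idempotents (R Quot jacobson_radical R) n e \<longrightarrow>
        (\<exists>f. complete_orthogonal_idempotents R n f \<and>
             (\<forall>i < n. jacobson_radical R +>\<^bsub>R\<^esub> f i = e i)))"

text \<open>Sequences are indexed from 0; the products below are
  \<open>x 0 \<otimes> x 1 \<otimes> \<dots> \<otimes> x n\<close> and \<open>x n \<otimes> \<dots> \<otimes> x 1 \<otimes> x 0\<close>.\<close>

definition left_T_nilpotent :: "('a, 'b) ring_scheme \<Rightarrow> 'a set \<Rightarrow> bool" where
  "left_T_nilpotent R A \<longleftrightarrow>
     (\<forall>x :: nat \<Rightarrow> 'a. range x \<subseteq> A \<longrightarrow>
        (\<exists>n. foldr (\<otimes>\<^bsub>R\<^esub>) (map x [0..<Suc n]) \<one>\<^bsub>R\<^esub> = \<zero>\<^bsub>R\<^esub>))"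

definition right_T_nilpotent :: "('a, 'b) ring_scheme \<Rightarrow> 'a set \<Rightarrow> bool" where
  "right_T_nilpotent R A \<longleftrightarrow>
     (\<forall>x :: nat \<Rightarrow> 'a. range x \<subseteq> A \<longrightarrow>
        (\<exists>n. foldr (\<otimes>\<^bsub>R\<^esub>) (map x (rev [0..<Suc n])) \<one>\<^bsub>R\<^esub> = \<zero>\<^bsub>R\<^esub>))"

definition left_perfect :: "('a, 'b) ring_scheme \<Rightarrow> bool" where
  "left_perfect R \<longleftrightarrow> semiperfect R \<and> left_T_nilpotent R (jacobson_radical R)"

definition right_perfect :: "('a, 'b) ring_scheme \<Rightarrow> bool" where
  "right_perfect R \<longleftrightarrow> semiperfect R \<and> right_T_nilpotent R (jacobson_radical R)"

end

theory Submission
  imports Defs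
begin

text \<open>Let \<open>C\<close> be the center of \<open>R\<close> and \<open>J\<close> its Jacobson radical. Central essentiality is
  used elementwise (\<open>centrally_essential_iff\<close>): every nonzero \<open>r\<close> has a central \<open>c\<close> with
  \<open>rc\<close> central and nonzero.

  If \<open>R\<close> is centrally essential, a simple submodule of \<open>R\<^sub>C\<close> meets \<open>C\<close> in a nonzero
  submodule, so it lies in \<open>C\<close>; hence so does the socle. If \<open>e\<close> is idempotent and
  \<open>x = ea(1 - e)\<close> were nonzero, a nonzero central multiple \<open>d = xc\<close> would satisfy
  \<open>d = ed = de = 0\<close>; applying this to \<open>e\<close> and to \<open>1 - e\<close> gives \<open>ea = eae = ae\<close>.

  For the converse it is enough that every nonzero \<open>r\<close> has a central \<open>c\<close> such that
  \<open>rc\<close> generates a simple submodule of \<open>R\<^sub>C\<close>: then \<open>rc\<close> lies in the socle, hence in \<open>C\<close>.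
  Such a \<open>c\<close> is the product of two factors. By T-nilpotence some multiple \<open>s = rb \<noteq> 0\<close> with
  \<open>b\<close> central is annihilated by \<open>C \<inter> J\<close>
  (\<open>T_nilpotent_annihilated_multiple\<close>); only products of central elements occur, so
  left and right T-nilpotence serve equally well. Since \<open>R/J\<close> is Artinian, there is then a
  central \<open>a\<close> with \<open>sa \<noteq> 0\<close> for which \<open>aR + J\<close> is minimal.

  That \<open>sa\<close> generates a simple module rests on \<open>central_quasi_inverse\<close>: modulo \<open>C \<inter> J\<close> the
  ring \<open>C\<close> is von Neumann regular. Indeed, for central \<open>c\<close> the chain
  \<open>c\<^sup>nR + J\<close> becomes stationary, so some \<open>c\<^sup>nx\<close> is idempotent modulo \<open>J\<close>. It lifts to an
  idempotent \<open>f\<close>, which is central by hypothesis, and \<open>f\<close> is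
  a multiple of \<open>c\<close> by a central element while \<open>c(1 - f)\<close> is in \<open>J\<close>. If now \<open>sad \<noteq> 0\<close>
  with \<open>d\<close> central, take \<open>f\<close> and \<open>z\<close> for \<open>ad\<close>, so that \<open>adz = f\<close>. Then \<open>sf \<noteq> 0\<close>, because
  \<open>s\<close> kills \<open>ad(1 - f)\<close>; minimality gives \<open>a \<in> fR + J\<close>, so \<open>a(1 - f) \<in> C \<inter> J\<close>
  is killed by \<open>s\<close> as well, and \<open>sa = saf = (sad)(za)\<close> is a multiple of \<open>sad\<close>.\<close>


section \<open>Submodules over the center\<close>

lemma (in ring) submodule_center_module_iff:
  "submodule L (center_ring R) (center_module R) \<longleftrightarrow>
     additive_subgroup L R \<and> (\<forall>a \<in> L. \<forall>c \<in> center R. a \<otimes> c \<in> L)"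
  by (auto simp: submodule_def submodule_axioms_def additive_subgroup_def subgroup_def m_inv_def
      center_module_def center_ring_def)

lemma (in ring) center_closed [simp]: "c \<in> center R \<Longrightarrow> c \<in> carrier R"
  by (simp add: center_def)

lemma (in ring) center_commutes: "c \<in> center R \<Longrightarrow> x \<in> carrier R \<Longrightarrow> c \<otimes> x = x \<otimes> c"
  unfolding center_def by blast

lemmas (in ring) center_subcring = subcringE[OF subcring_center]

lemma (in ring) center_pow_closed: "c \<in> center R \<Longrightarrow> c [^] (n :: nat) \<in> center R"
  by (induction n) (simp_all add: center_subcring)

text \<open>Both the submodules over the center and the right ideals are closed under right
  multiplication by \<open>-1\<close>, so that neither needs a separate argument for negatives.\<close>
lemma (in ring) additive_subgroupI_minus_one:
  assumes "L \<subseteq> carrier R" "\<zero> \<in> L"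
    and "\<And>x y. x \<in> L \<Longrightarrow> y \<in> L \<Longrightarrow> x \<oplus> y \<in> L"
    and neg: "\<And>x. x \<in> L \<Longrightarrow> x \<otimes> \<ominus> \<one> \<in> L"
  shows "additive_subgroup L R"
proof (intro additive_subgroup.intro subgroup.intro)
  fix x assume x: "x \<in> L"
  then have "x \<otimes> \<ominus> \<one> = \<ominus> x" using assms(1) by (auto simp: r_minus)
  then show "inv\<^bsub>add_monoid R\<^esub> x \<in> L" using neg[OF x] by (simp add: a_inv_def)
qed (use assms in auto)

lemma (in ring) submodule_cyclic:
  assumes r: "r \<in> carrier R"
  shows "submodule ((\<lambda>c. r \<otimes> c) ` center R) (center_ring R) (center_module R)"
  unfolding submodule_center_module_iff
proof (intro conjI additive_subgroupI_minus_one ballI)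
  let ?L = "(\<lambda>c. r \<otimes> c) ` center R"
  show "?L \<subseteq> carrier R" using r by auto
  show "\<zero> \<in> ?L"
    using r center_subcring(2) by (auto intro: image_eqI[of _ _ \<zero>])
  show "x \<oplus> y \<in> ?L" if "x \<in> ?L" "y \<in> ?L" for x y
    using that r center_subcring(7) by (auto simp flip: r_distr)
  show mult: "a \<otimes> c \<in> ?L" if "a \<in> ?L" "c \<in> center R" for a c
    using that r center_subcring(6) by (auto simp: m_assoc)
  show "x \<otimes> \<ominus> \<one> \<in> ?L" if "x \<in> ?L" for x
    using that center_subcring(3,5) by (intro mult)
qed

lemma (in ring) centrally_essential_iff:
  "centrally_essential R \<longleftrightarrow>
     (\<forall>r \<in> carrier R. r \<noteq> \<zero> \<longrightarrow> (\<exists>c \<in> center R. r \<otimes> c \<in> center R \<and> r \<otimes> c \<noteq> \<zero>))"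
    (is "_ \<longleftrightarrow> ?elementwise")
proof
  assume ess: "centrally_essential R"
  show ?elementwise
  proof (intro ballI impI)
    fix r assume r: "r \<in> carrier R" "r \<noteq> \<zero>"
    let ?L = "(\<lambda>c. r \<otimes> c) ` center R"
    have "r = r \<otimes> \<one>" using r by simp
    then have "r \<in> ?L" using center_subcring(3) by blast
    then have "?L \<inter> center R \<noteq> {\<zero>}"
      using ess submodule_cyclic[OF r(1)] r(2)
      by (auto simp: centrally_essential_def essential_submodule_def center_module_def)
    moreover have "\<zero> \<in> ?L \<inter> center R"
      using r center_subcring(2) by (auto intro: image_eqI[of _ _ \<zero>])
    ultimately show "\<exists>c \<in> center R. r \<otimes> c \<in> center R \<and> r \<otimes> c \<noteq> \<zero>" by blast
  qed
next
  assume elementwise: ?elementwise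
  show "centrally_essential R"
    unfolding centrally_essential_def essential_submodule_def
  proof (intro conjI allI impI submodule_center)
    fix L
    assume "submodule L (center_ring R) (center_module R) \<and> L \<noteq> {\<zero>\<^bsub>center_module R\<^esub>}"
    then have L: "additive_subgroup L R" "\<And>a c. a \<in> L \<Longrightarrow> c \<in> center R \<Longrightarrow> a \<otimes> c \<in> L"
      and nz: "L \<noteq> {\<zero>}"
      unfolding submodule_center_module_iff by (auto simp: center_module_def)
    obtain r where r: "r \<in> L" "r \<noteq> \<zero>"
      using nz additive_subgroup.zero_closed[OF L(1)] by blast
    then obtain c where c: "c \<in> center R" "r \<otimes> c \<in> center R" "r \<otimes> c \<noteq> \<zero>"
      using elementwise additive_subgroup.a_Hcarr[OF L(1)] by blast
    then show "L \<inter> center R \<noteq> {\<zero>\<^bsub>center_module R\<^esub>}"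
      using L(2)[OF r(1) c(1)] by (auto simp: center_module_def)
  qed
qed


section \<open>Idempotents and the socle\<close>

lemma (in ring) minus_distr:
  assumes "x \<in> carrier R" "y \<in> carrier R" "z \<in> carrier R"
  shows r_minus_distr: "x \<otimes> (y \<ominus> z) = x \<otimes> y \<ominus> x \<otimes> z"
    and l_minus_distr: "(y \<ominus> z) \<otimes> x = y \<otimes> x \<ominus> z \<otimes> x"
  using assms by (simp_all add: minus_eq r_distr l_distr r_minus l_minus)

lemma (in ring) minus_self [simp]: "x \<in> carrier R \<Longrightarrow> x \<ominus> x = \<zero>"
  by simp

text \<open>A multiple of \<open>ea(1 - e)\<close> by a central element is fixed by \<open>e\<close> on the left and
  annihilated by \<open>e\<close> on the right. If it is central, the two actions agree.\<close>
lemma (in ring) idempotent_off_diagonal_zero: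
  assumes ess: "centrally_essential R"
    and e: "e \<in> carrier R" "e \<otimes> e = e" and a: "a \<in> carrier R"
  shows "e \<otimes> a \<otimes> (\<one> \<ominus> e) = \<zero>"
proof (rule ccontr)
  let ?x = "e \<otimes> a \<otimes> (\<one> \<ominus> e)"
  assume "?x \<noteq> \<zero>"
  then obtain c where c: "c \<in> center R" "?x \<otimes> c \<in> center R" "?x \<otimes> c \<noteq> \<zero>"
    using ess e a unfolding centrally_essential_iff by (metis m_closed minus_closed one_closed)
  have cc: "c \<in> carrier R" using c(1) by simp
  have orth: "(\<one> \<ominus> e) \<otimes> e = \<zero>"
    using e by (simp add: minus_eq l_distr l_minus r_neg)
  have "?x \<otimes> c = e \<otimes> (?x \<otimes> c)"
    using e a cc by (simp flip: m_assoc)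
  also have "\<dots> = (?x \<otimes> c) \<otimes> e" using center_commutes[OF c(2) e(1)] by simp
  also have "\<dots> = e \<otimes> a \<otimes> ((\<one> \<ominus> e) \<otimes> e) \<otimes> c"
    using center_commutes[OF c(1) e(1)] e a cc by (simp add: m_assoc)
  also have "\<dots> = \<zero>" using orth e a cc by simp
  finally show False using c(3) by simp
qed

lemma (in ring) centrally_essential_imp_idempotent_central:
  assumes ess: "centrally_essential R" and e: "e \<in> carrier R" "e \<otimes> e = e"
  shows "e \<in> center R"
proof -
  let ?f = "\<one> \<ominus> e"
  have f: "?f \<in> carrier R" "\<one> \<ominus> ?f = e"
    using e(1) by (simp_all add: minus_eq minus_add r_neg2)
  have "?f \<otimes> e = \<zero>" using e by (simp add: l_minus_distr)
  then have f2: "?f \<otimes> ?f = ?f"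
    using r_minus_distr[OF f(1) one_closed e(1)] f(1) by (simp add: minus_eq[of ?f \<zero>])
  have "e \<otimes> a = a \<otimes> e" if a: "a \<in> carrier R" for a
  proof -
    have "e \<otimes> a \<otimes> ?f = \<zero>" by (rule idempotent_off_diagonal_zero[OF ess e a])
    then have "e \<otimes> a \<ominus> e \<otimes> a \<otimes> e = \<zero>"
      using e a by (simp add: r_minus_distr)
    then have "e \<otimes> a = e \<otimes> a \<otimes> e" using e(1) a by simp
    moreover have "?f \<otimes> a \<otimes> e = \<zero>"
      using idempotent_off_diagonal_zero[OF ess f(1) f2 a] unfolding f(2) .
    then have "a \<otimes> e \<ominus> e \<otimes> a \<otimes> e = \<zero>"
      using e a by (simp add: l_minus_distr)
    then have "a \<otimes> e = e \<otimes> a \<otimes> e" using e(1) a by simp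
    ultimately show ?thesis by simp
  qed
  then show ?thesis using e(1) unfolding center_def by blast
qed

lemma (in ring) simple_submodule_central:
  assumes ess: "centrally_essential R"
    and S: "simple_submodule S (center_ring R) (center_module R)"
  shows "S \<subseteq> center R"
proof -
  have C: "submodule (center R) (center_ring R) (center_module R)" by (rule submodule_center)
  have sub: "submodule S (center_ring R) (center_module R)"
    and nz: "S \<noteq> {\<zero>\<^bsub>center_module R\<^esub>}" using S by (auto simp: simple_submodule_def)
  have "submodule (S \<inter> center R) (center_ring R) (center_module R)"
    using sub C unfolding submodule_center_module_iff
    by (simp add: additive_subgroup_def add.subgroups_Inter_pair)
  moreover have "S \<inter> center R \<noteq> {\<zero>\<^bsub>center_module R\<^esub>}"
    using ess sub nz by (auto simp: centrally_essential_def essential_submodule_def)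
  ultimately have "S \<inter> center R = S"
    using S by (meson inf_le1 simple_submodule_def)
  then show ?thesis by blast
qed

lemma (in ring) socle_subset_center:
  assumes "\<And>S. simple_submodule S (center_ring R) (center_module R) \<Longrightarrow> S \<subseteq> center R"
  shows "socle (center_ring R) (center_module R) \<subseteq> center R"
proof
  interpret M: Module.module "center_ring R" "center_module R" by (rule module_center_module)
  fix x assume "x \<in> socle (center_ring R) (center_module R)"
  then obtain f F where F: "finite F" "x = finsum (center_module R) f F"
    and fF: "\<forall>S \<in> F. simple_submodule S (center_ring R) (center_module R) \<and> f S \<in> S"
    unfolding socle_def by blast
  have f: "f S \<in> center R" if "S \<in> F" for S
    using that fF assms[of S] by blast
  have "finsum (center_module R) f F \<in> center R" using F(1) f
  proof (induction rule: finite_induct)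
    case empty
    then show ?case using center_subcring(2)
      by (simp only: M.finsum_empty) (simp add: center_module_def)
  next
    case (insert S F)
    then have "f \<in> F \<rightarrow> carrier (center_module R)" "f S \<in> carrier (center_module R)"
      by (auto simp: center_module_def)
    then have "finsum (center_module R) f (insert S F) = f S \<oplus> finsum (center_module R) f F"
      using insert.hyps by (simp add: M.finsum_insert) (simp add: center_module_def)
    then show ?case using insert center_subcring(7) by simp
  qed
  then show "x \<in> center R" using F(2) by simp
qed

lemma (in ring) simple_submodule_subset_socle:
  assumes S: "simple_submodule S (center_ring R) (center_module R)"
  shows "S \<subseteq> socle (center_ring R) (center_module R)"
proof
  interpret M: Module.module "center_ring R" "center_module R" by (rule module_center_module)
  fix x assume x: "x \<in> S"
  have "S \<subseteq> carrier (center_module R)"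
    using S by (auto simp: simple_submodule_def submodule_def dest: subgroup.mem_carrier)
  then have "x = finsum (center_module R) (\<lambda>_. x) {S}"
    using x by (auto simp: M.finsum_insert)
  then show "x \<in> socle (center_ring R) (center_module R)"
    unfolding socle_def using S x by blast
qed


section \<open>Right ideals and the Jacobson radical\<close>

lemma (in ring) right_idealI:
  assumes "L \<subseteq> carrier R" "\<zero> \<in> L"
    and "\<And>x y. x \<in> L \<Longrightarrow> y \<in> L \<Longrightarrow> x \<oplus> y \<in> L"
    and "\<And>x y. x \<in> L \<Longrightarrow> y \<in> carrier R \<Longrightarrow> x \<otimes> y \<in> L"
  shows "right_ideal L R"
  unfolding right_ideal_def
  by (intro conjI ballI additive_subgroupI_minus_one assms) auto

lemma (in ring) right_idealD:
  assumes "right_ideal I R"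
  shows "\<And>x. x \<in> I \<Longrightarrow> x \<in> carrier R" "\<zero> \<in> I"
    and "\<And>x y. x \<in> I \<Longrightarrow> y \<in> I \<Longrightarrow> x \<oplus> y \<in> I"
    and "\<And>x y. x \<in> I \<Longrightarrow> y \<in> carrier R \<Longrightarrow> x \<otimes> y \<in> I"
  using assms additive_subgroup.a_Hcarr additive_subgroup.zero_closed additive_subgroup.a_closed
  unfolding right_ideal_def by fastforce+

lemma (in ring) right_ideal_principal:
  assumes a: "a \<in> carrier R"
  shows "right_ideal ((\<lambda>x. a \<otimes> x) ` carrier R) R"
proof (rule right_idealI)
  let ?L = "(\<lambda>x. a \<otimes> x) ` carrier R"
  show "?L \<subseteq> carrier R" using a by auto
  show "\<zero> \<in> ?L" using a by (auto intro: image_eqI[of _ _ \<zero>])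
  show "x \<oplus> y \<in> ?L" if "x \<in> ?L" "y \<in> ?L" for x y
    using that a by (auto simp flip: r_distr)
  show "x \<otimes> y \<in> ?L" if "x \<in> ?L" "y \<in> carrier R" for x y
    using that a by (auto simp: m_assoc)
qed

text \<open>The descending chain condition as a minimality principle: \<open>aR\<close> is minimal among the
  principal right ideals with generator in \<open>A\<close>. If there were no such \<open>a\<close>, dependent choice
  would give a strictly descending chain.\<close>
lemma (in ring) right_artinian_minimal_principal:
  assumes art: "right_artinian R" and A: "A \<subseteq> carrier R" "A \<noteq> {}"
  obtains (minimal) a where "a \<in> A"
    and "\<And>b x. b \<in> A \<Longrightarrow> x \<in> carrier R \<Longrightarrow> b = a \<otimes> x \<Longrightarrow> \<exists>y \<in> carrier R. a = b \<otimes> y"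
proof (rule ccontr)
  let ?I = "\<lambda>a. (\<lambda>x. a \<otimes> x) ` carrier R"
  assume "\<not> thesis"
  then have "\<exists>b. b \<in> A \<and> b \<in> ?I a \<and> a \<notin> ?I b" if "a \<in> A" for a
    using that minimal[of a] by blast
  then obtain s where s: "\<And>n. s n \<in> A" "\<And>n. s (Suc n) \<in> ?I (s n) \<and> s n \<notin> ?I (s (Suc n))"
    using A(2) dependent_nat_choice[of "\<lambda>_ a. a \<in> A" "\<lambda>_ a b. b \<in> ?I a \<and> a \<notin> ?I b"]
    by (metis ex_in_conv)
  have car: "s n \<in> carrier R" for n using s(1) A(1) by blast
  have "?I (s (Suc n)) \<subseteq> ?I (s n)" for n
    using s(2)[of n] car[of n] by (auto simp: m_assoc)
  then have "decseq (\<lambda>n. ?I (s n))" by (rule decseq_SucI)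
  then have "\<exists>n. \<forall>m \<ge> n. ?I (s m) = ?I (s n)"
    using art right_ideal_principal[OF car] unfolding right_artinian_def
    by (elim allE[of _ "\<lambda>n. ?I (s n)"]) simp
  then obtain n where stable: "\<forall>m \<ge> n. ?I (s m) = ?I (s n)" by blast
  have "?I (s (Suc n)) = ?I (s n)" by (rule stable[rule_format]) simp
  moreover have "s n \<in> ?I (s n)" using car[of n] by (auto intro: image_eqI[of _ _ \<one>])
  ultimately show False using s(2)[of n] by simp
qed

lemma (in ring) right_ideal_add_mult:
  assumes I: "right_ideal I R" and K: "right_ideal K R" and r: "r \<in> carrier R"
  shows "right_ideal {i \<oplus> r \<otimes> k | i k. i \<in> I \<and> k \<in> K} R" (is "right_ideal ?L R")
proof (rule right_idealI)
  note I' = right_idealD[OF I] and K' = right_idealD[OF K]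
  show "?L \<subseteq> carrier R" using I'(1) K'(1) r by auto
  have "\<zero> = \<zero> \<oplus> r \<otimes> \<zero>" using r by simp
  then show "\<zero> \<in> ?L" using I'(2) K'(2) by blast
  show "x \<oplus> y \<in> ?L" if xy: "x \<in> ?L" "y \<in> ?L" for x y
  proof -
    obtain i k i' k' where "x = i \<oplus> r \<otimes> k" "y = i' \<oplus> r \<otimes> k'"
      and mem: "i \<in> I" "k \<in> K" "i' \<in> I" "k' \<in> K" using xy by blast
    then have "x \<oplus> y = (i \<oplus> i') \<oplus> r \<otimes> (k \<oplus> k')"
      using I'(1) K'(1) r by (simp add: r_distr a_ac)
    then show ?thesis using mem I'(3) K'(3) by blast
  qed
  show "x \<otimes> y \<in> ?L" if x: "x \<in> ?L" and y: "y \<in> carrier R" for x y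
  proof -
    obtain i k where "x = i \<oplus> r \<otimes> k" and mem: "i \<in> I" "k \<in> K" using x by blast
    then have "x \<otimes> y = i \<otimes> y \<oplus> r \<otimes> (k \<otimes> y)"
      using I'(1) K'(1) r y by (simp add: l_distr m_assoc)
    then show ?thesis using mem y I'(4) K'(4) by blast
  qed
qed

text \<open>The right ideal \<open>I + rK\<close> contains \<open>I\<close> strictly, so by maximality it is everything.\<close>
lemma (in ring) maximal_right_ideal_sum:
  assumes I: "maximal_right_ideal I R" and K: "right_ideal K R" and r: "r \<in> carrier R"
    and k: "k \<in> K" "r \<otimes> k \<notin> I" and y: "y \<in> carrier R"
  obtains i k where "i \<in> I" "k \<in> K" "y = i \<oplus> r \<otimes> k"
proof -
  have ri: "right_ideal I R" using I by (simp add: maximal_right_ideal_def)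
  note I' = right_idealD[OF ri] and K' = right_idealD[OF K]
  let ?L = "{i \<oplus> r \<otimes> k | i k. i \<in> I \<and> k \<in> K}"
  have "i \<in> ?L" if "i \<in> I" for i
  proof -
    have "i = i \<oplus> r \<otimes> \<zero>" using I'(1)[OF that] r by simp
    then show ?thesis using that K'(2) by blast
  qed
  then have "I \<subseteq> ?L" by blast
  moreover have "r \<otimes> k \<in> ?L"
  proof -
    have "r \<otimes> k = \<zero> \<oplus> r \<otimes> k" using k K'(1) r by simp
    then show ?thesis using k(1) I'(2) by blast
  qed
  ultimately have "?L = carrier R"
    using I k(2) right_ideal_add_mult[OF ri K r] unfolding maximal_right_ideal_def by blast
  then show ?thesis using y that by blast
qed

text \<open>This is what makes the radical a left ideal. Left multiplication by \<open>r\<close> embeds the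
  quotient of \<open>R\<close> by the transporter into the simple module \<open>R/I\<close>, and the embedding is not
  zero; here the argument is carried out on elements.\<close>
lemma (in ring) maximal_right_ideal_transporter:
  assumes I: "maximal_right_ideal I R" and r: "r \<in> carrier R" "r \<notin> I"
  shows "maximal_right_ideal {y \<in> carrier R. r \<otimes> y \<in> I} R" (is "maximal_right_ideal ?T R")
  unfolding maximal_right_ideal_def
proof (intro conjI allI impI)
  have ri: "right_ideal I R" using I by (simp add: maximal_right_ideal_def)
  note I' = right_idealD[OF ri]
  show "right_ideal ?T R"
    using r(1) I' by (intro right_idealI) (auto simp: r_distr simp flip: m_assoc)
  have "\<one> \<notin> ?T" using r by simp
  then show "?T \<noteq> carrier R" by blast
  fix K assume "right_ideal K R \<and> ?T \<subseteq> K"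
  then have K: "right_ideal K R" and sub: "?T \<subseteq> K" by auto
  note K' = right_idealD[OF K]
  have "K = carrier R" if ne: "K \<noteq> ?T"
  proof -
    obtain k where k: "k \<in> K" "r \<otimes> k \<notin> I" using ne sub K'(1) by blast
    have "y \<in> K" if y: "y \<in> carrier R" for y
    proof -
      obtain i k' where ik: "i \<in> I" "k' \<in> K" "r \<otimes> y = i \<oplus> r \<otimes> k'"
        using maximal_right_ideal_sum[OF I K r(1) k] r(1) y by (metis m_closed)
      have car: "i \<in> carrier R" "k' \<in> carrier R" using ik I'(1) K'(1) by auto
      have "r \<otimes> (y \<ominus> k') = i"
        using ik(3) car r(1) y by (simp add: minus_eq r_distr r_minus a_assoc r_neg)
      then have "y \<ominus> k' \<in> K" using sub ik(1) y car by auto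
      then have "(y \<ominus> k') \<oplus> k' \<in> K" using ik(2) K'(3) by blast
      then show ?thesis using y car by (simp add: minus_eq a_assoc l_neg)
    qed
    then show ?thesis using K'(1) by blast
  qed
  then show "K = ?T \<or> K = carrier R" by blast
qed

lemma (in ring) ideal_jacobson_radical: "ideal (jacobson_radical R) R"
proof (rule idealI[OF ring_axioms])
  let ?J = "jacobson_radical R"
  have max: "right_ideal I R" if "maximal_right_ideal I R" for I
    using that by (simp add: maximal_right_ideal_def)
  have "right_ideal ?J R"
    using right_idealD[OF max] by (intro right_idealI) (auto simp: jacobson_radical_def)
  then show "subgroup ?J (add_monoid R)" "\<And>a x. a \<in> ?J \<Longrightarrow> x \<in> carrier R \<Longrightarrow> a \<otimes> x \<in> ?J"
    by (auto simp: right_ideal_def additive_subgroup_def)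
  fix a x assume a: "a \<in> ?J" and x: "x \<in> carrier R"
  have "x \<otimes> a \<in> I" if I: "maximal_right_ideal I R" for I
  proof (cases "x \<in> I")
    case True
    then show ?thesis using right_idealD(4)[OF max[OF I]] a by (simp add: jacobson_radical_def)
  next
    case False
    then show ?thesis
      using maximal_right_ideal_transporter[OF I x] a by (auto simp: jacobson_radical_def)
  qed
  then show "x \<otimes> a \<in> ?J" using a x by (simp add: jacobson_radical_def)
qed

text \<open>If \<open>c\<close> were outside a maximal right ideal \<open>I\<close>, then \<open>1 = i + cy\<close> with \<open>i\<close> in \<open>I\<close>.
  Multiplying on the right by \<open>c\<^sup>m\<close>, which is central, shows that \<open>c\<^bsup>m+1\<^esup> \<in> I\<close> implies \<open>c\<^sup>m \<in> I\<close>. So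
  \<open>c\<^sup>n = 0 \<in> I\<close> forces \<open>1 \<in> I\<close>.\<close>
lemma (in ring) central_nilpotent_in_jacobson_radical:
  assumes c: "c \<in> center R" and nil: "c [^] (n :: nat) = \<zero>"
  shows "c \<in> jacobson_radical R"
  unfolding jacobson_radical_def
proof (intro CollectI conjI allI impI)
  have cc [simp]: "c \<in> carrier R" using c by simp
  then show "c \<in> carrier R" .
  fix I assume I: "maximal_right_ideal I R"
  then have ri: "right_ideal I R" by (simp add: maximal_right_ideal_def)
  note I' = right_idealD[OF ri]
  show "c \<in> I"
  proof (rule ccontr)
    assume "c \<notin> I"
    then have "c \<otimes> \<one> \<notin> I" by simp
    moreover have "right_ideal (carrier R) R" by (intro right_idealI) auto
    ultimately obtain i y where iy: "i \<in> I" "y \<in> carrier R" "\<one> = i \<oplus> c \<otimes> y"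
      using maximal_right_ideal_sum[OF I _ cc one_closed] by blast
    have descend: "c [^] m \<in> I" if m: "c [^] Suc m \<in> I" for m
    proof -
      let ?p = "c [^] m"
      have "?p = (i \<oplus> c \<otimes> y) \<otimes> ?p" by (simp flip: iy(3))
      also have "\<dots> = i \<otimes> ?p \<oplus> c \<otimes> (y \<otimes> ?p)"
        using iy I'(1) by (simp add: l_distr m_assoc)
      also have "c \<otimes> (y \<otimes> ?p) = c [^] Suc m \<otimes> y"
        using center_commutes[OF center_pow_closed[OF c], of y m] iy(2)
        by (simp only: nat_pow_Suc2[OF cc]) (simp add: m_assoc)
      finally have "?p = i \<otimes> ?p \<oplus> c [^] Suc m \<otimes> y" .
      moreover have "i \<otimes> ?p \<in> I" using iy(1) I'(4) by simp
      moreover have "c [^] Suc m \<otimes> y \<in> I" using m iy(2) I'(4) by blast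
      ultimately show ?thesis using I'(3) by metis
    qed
    have "\<one> \<in> I" if "c [^] k \<in> I" for k :: nat
      using that
    proof (induction k)
      case (Suc k)
      then show ?case using descend by blast
    qed simp
    moreover have "c [^] n \<in> I" using nil I'(2) by simp
    ultimately have "\<one> \<in> I" by blast
    then have "\<one> \<otimes> c \<in> I" using I'(4) cc by blast
    with \<open>c \<notin> I\<close> show False by simp
  qed
qed

text \<open>The inverse is the finite geometric series \<open>1 + a + \<dots> + a\<^bsup>n-1\<^esup>\<close>.\<close>
lemma (in ring) one_minus_nilpotent_right_inverse:
  assumes a: "a \<in> carrier R" and nil: "a [^] (n :: nat) = \<zero>"
  obtains u where "u \<in> carrier R" "(\<one> \<ominus> a) \<otimes> u = \<one>"
proof -
  have "\<exists>u \<in> carrier R. (\<one> \<ominus> a) \<otimes> u = \<one> \<ominus> a [^] m" for m :: nat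
  proof (induction m)
    case 0
    then show ?case using a by (intro bexI[of _ \<zero>]) (auto simp: minus_eq r_neg)
  next
    case (Suc m)
    then obtain u where u: "u \<in> carrier R" "(\<one> \<ominus> a) \<otimes> u = \<one> \<ominus> a [^] m" by blast
    have "(\<one> \<ominus> a) \<otimes> (u \<oplus> a [^] m) = (\<one> \<ominus> a [^] m) \<oplus> (a [^] m \<ominus> a \<otimes> a [^] m)"
      using u a by (simp add: r_distr) (simp add: minus_eq l_distr l_minus)
    also have "\<dots> = \<one> \<ominus> a [^] Suc m"
      using a by (simp only: nat_pow_Suc2[OF a]) (simp add: minus_eq a_assoc r_neg1)
    finally show ?case using u a by (intro bexI[of _ "u \<oplus> a [^] m"]) auto
  qed
  from this[of n] show thesis using that nil by (auto simp: minus_eq)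
qed


section \<open>T-nilpotence\<close>

text \<open>The disjunction is what is known of the radical when the ring is perfect on an unspecified
  side.\<close>
definition T_nilpotent :: "('a, 'b) ring_scheme \<Rightarrow> 'a set \<Rightarrow> bool" where
  "T_nilpotent R A \<longleftrightarrow> left_T_nilpotent R A \<or> right_T_nilpotent R A"

lemma (in ring) T_nilpotent_imp_nil:
  assumes T: "T_nilpotent R A" and a: "a \<in> A" "a \<in> carrier R"
  obtains n :: nat where "a [^] n = \<zero>"
proof -
  have pow: "foldr (\<otimes>) (replicate n a) \<one> = a [^] n" for n
    by (induction n) (use nat_pow_Suc2[OF a(2)] in simp_all)
  have "range (\<lambda>_ :: nat. a) \<subseteq> A" using a by auto
  then consider (left) n where "foldr (\<otimes>) (map (\<lambda>_. a) [0..<Suc n]) \<one> = \<zero>"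
    | (right) n where "foldr (\<otimes>) (map (\<lambda>_. a) (rev [0..<Suc n])) \<one> = \<zero>"
    using T unfolding T_nilpotent_def left_T_nilpotent_def right_T_nilpotent_def by blast
  then obtain n where "foldr (\<otimes>) (replicate (Suc n) a) \<one> = \<zero>"
    by cases (simp_all only: map_replicate_const length_rev length_upt diff_zero)
  then show thesis using that unfolding pow by blast
qed

lemma (in ring) foldr_mult_snoc:
  "set xs \<subseteq> carrier R \<Longrightarrow> y \<in> carrier R \<Longrightarrow>
    foldr (\<otimes>) (xs @ [y]) \<one> = foldr (\<otimes>) xs \<one> \<otimes> y \<and> foldr (\<otimes>) xs \<one> \<in> carrier R"
  by (induction xs) (auto simp: m_assoc)

text \<open>Otherwise every nonzero \<open>rc\<close> with \<open>c\<close> central stays nonzero after multiplication by a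
  further central element of \<open>J\<close>. Iterating from \<open>c = 1\<close> gives central elements
  \<open>m 0, m 1, \<dots>\<close> of \<open>J\<close> none of whose products \<open>m 0 \<dots> m n\<close> kills \<open>r\<close>. They commute, so
  this contradicts T-nilpotence on either side.\<close>
lemma (in ring) T_nilpotent_annihilated_multiple:
  assumes T: "T_nilpotent R J" and r: "r \<in> carrier R" "r \<noteq> \<zero>"
  obtains (annihilated) c where "c \<in> center R" "r \<otimes> c \<noteq> \<zero>" "\<And>m. m \<in> center R \<inter> J \<Longrightarrow> r \<otimes> c \<otimes> m = \<zero>"
proof (rule ccontr)
  assume "\<not> thesis"
  then have "\<exists>m. m \<in> center R \<inter> J \<and> r \<otimes> (c \<otimes> m) \<noteq> \<zero>"
    if "c \<in> center R" "r \<otimes> c \<noteq> \<zero>" for c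
    using that annihilated[of c] r(1) m_assoc[OF r(1), of c] center_closed by (metis IntD1)
  then obtain g where g: "\<And>c. c \<in> center R \<Longrightarrow> r \<otimes> c \<noteq> \<zero> \<Longrightarrow>
      g c \<in> center R \<inter> J \<and> r \<otimes> (c \<otimes> g c) \<noteq> \<zero>" by metis
  define p where "p = rec_nat \<one> (\<lambda>_ c. c \<otimes> g c)"
  define m where "m n = g (p n)" for n :: nat
  have p0: "p 0 = \<one>" and pS: "p (Suc n) = p n \<otimes> m n" for n by (simp_all add: p_def m_def)
  have p: "p n \<in> center R \<and> r \<otimes> p n \<noteq> \<zero>" for n
  proof (induction n)
    case 0
    then show ?case using r center_subcring(3) by (simp add: p0)
  next
    case (Suc n)
    then show ?case using g[of "p n"] center_subcring(6) by (simp add: pS m_def)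
  qed
  have m: "m n \<in> center R \<inter> J" for n using g p by (simp add: m_def)
  have mc: "m n \<in> carrier R" for n using m by auto
  have "foldr (\<otimes>) (map m [0..<n]) \<one> = p n" for n
  proof (induction n)
    case (Suc n)
    have "set (map m [0..<n]) \<subseteq> carrier R" using mc by auto
    then show ?case using foldr_mult_snoc[of "map m [0..<n]" "m n"] mc Suc
      by (simp add: pS del: foldr_append)
  qed (simp add: p0)
  moreover have "foldr (\<otimes>) (map m (rev [0..<n])) \<one> = p n" for n
  proof (induction n)
    case (Suc n)
    then show ?case using center_commutes[of "p n" "m n"] p mc by (simp add: pS)
  qed (simp add: p0)
  moreover have "range m \<subseteq> J" using m by auto
  ultimately have "\<exists>n. p (Suc n) = \<zero>"
    using T unfolding T_nilpotent_def left_T_nilpotent_def right_T_nilpotent_def by metis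
  then show False using p r(1) by (metis r_null)
qed


section \<open>Semiperfect rings\<close>

text \<open>Here \<open>b - ax \<in> J\<close> means that \<open>b\<close> lies in \<open>aR + J\<close>; so \<open>a\<close> is an element of \<open>A\<close> for which
  \<open>aR + J\<close> is minimal.\<close>
lemma (in ring) semiperfect_minimal_mod_jacobson_radical:
  assumes sp: "semiperfect R" and A: "A \<subseteq> carrier R" "A \<noteq> {}"
  obtains a where "a \<in> A"
    and "\<forall>b \<in> A. \<forall>x \<in> carrier R. b \<ominus> a \<otimes> x \<in> jacobson_radical R \<longrightarrow>
      (\<exists>y \<in> carrier R. a \<ominus> b \<otimes> y \<in> jacobson_radical R)"
proof -
  let ?J = "jacobson_radical R"
  let ?Q = "R Quot ?J"
  interpret J: ideal ?J R by (rule ideal_jacobson_radical)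
  interpret Q: ring ?Q by (rule J.quotient_is_ring)
  interpret h: ring_hom_ring R ?Q "(+>) ?J" by (rule J.rcos_ring_hom_ring)
  have eq: "?J +> a = ?J +> b \<otimes> x \<longleftrightarrow> a \<ominus> b \<otimes> x \<in> ?J"
    if "a \<in> carrier R" "b \<in> carrier R" "x \<in> carrier R" for a b x
    using quotient_eq_iff_same_a_r_cos[OF ideal_jacobson_radical] that by simp
  have carQ: "\<exists>x \<in> carrier R. U = ?J +> x" if "U \<in> carrier ?Q" for U :: "'a set"
    using that unfolding FactRing_def A_RCOSETS_def' by simp
  have "right_artinian ?Q" using sp by (simp add: semiperfect_def artinian_def)
  moreover have "(\<lambda>a. ?J +> a) ` A \<subseteq> carrier ?Q" using A(1) by (auto intro: h.hom_closed)
  ultimately obtain U where U: "U \<in> (\<lambda>a. ?J +> a) ` A"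
    and min: "\<And>B Y. B \<in> (\<lambda>a. ?J +> a) ` A \<Longrightarrow> Y \<in> carrier ?Q \<Longrightarrow> B = U \<otimes>\<^bsub>?Q\<^esub> Y \<Longrightarrow>
      \<exists>Y \<in> carrier ?Q. U = B \<otimes>\<^bsub>?Q\<^esub> Y"
    using A(2) Q.right_artinian_minimal_principal by (metis image_is_empty)
  then obtain a where a: "a \<in> A" "U = ?J +> a" by blast
  show thesis
  proof (rule that[OF a(1)], intro ballI impI)
    fix b x assume b: "b \<in> A" and x: "x \<in> carrier R" and bx: "b \<ominus> a \<otimes> x \<in> ?J"
    have car: "a \<in> carrier R" "b \<in> carrier R" using a b A(1) by auto
    have "?J +> b = U \<otimes>\<^bsub>?Q\<^esub> (?J +> x)" using eq[OF car(2,1) x] bx a(2) car x by simp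
    then obtain Y where "Y \<in> carrier ?Q" "U = (?J +> b) \<otimes>\<^bsub>?Q\<^esub> Y"
      using min[of "?J +> b" "?J +> x"] b x h.hom_closed by blast
    then obtain y where y: "y \<in> carrier R" "?J +> a = ?J +> b \<otimes> y"
      using carQ a(2) car by fastforce
    then show "\<exists>y \<in> carrier R. a \<ominus> b \<otimes> y \<in> ?J" using eq[OF car] by blast
  qed
qed

text \<open>The classes of \<open>e\<close> and \<open>1 - e\<close> form a complete orthogonal system of length two.\<close>
lemma (in ring) semiperfect_lift_idempotent:
  assumes sp: "semiperfect R" and e: "e \<in> carrier R" "e \<otimes> e \<ominus> e \<in> jacobson_radical R"
  obtains f where "f \<in> carrier R" "f \<otimes> f = f" "f \<ominus> e \<in> jacobson_radical R"
proof -
  let ?J = "jacobson_radical R"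
  let ?Q = "R Quot ?J"
  interpret J: ideal ?J R by (rule ideal_jacobson_radical)
  interpret Q: ring ?Q by (rule J.quotient_is_ring)
  interpret h: ring_hom_ring R ?Q "(+>) ?J" by (rule J.rcos_ring_hom_ring)
  define E where "E i = (if i = 0 then ?J +> e else \<one>\<^bsub>?Q\<^esub> \<ominus>\<^bsub>?Q\<^esub> (?J +> e))" for i :: nat
  have eQ: "?J +> e \<in> carrier ?Q" using e(1) by (rule h.hom_closed)
  have "?J +> e \<otimes> e = ?J +> e"
    using quotient_eq_iff_same_a_r_cos[OF ideal_jacobson_radical] e by simp
  then have idem: "(?J +> e) \<otimes>\<^bsub>?Q\<^esub> (?J +> e) = ?J +> e" using e(1) by simp
  have "complete_orthogonal_idempotents ?Q 2 E"
  proof -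
    have "{..<2 :: nat} = {0, 1}" by auto
    then have "finsum ?Q E {..<2} = E 0 \<oplus>\<^bsub>?Q\<^esub> E 1"
      using eQ by (simp add: Q.finsum_insert E_def)
    also have "\<dots> = \<one>\<^bsub>?Q\<^esub>"
      using eQ by (simp add: E_def Q.minus_eq Q.a_comm[of "\<one>\<^bsub>?Q\<^esub>"] Q.r_neg2)
    finally show ?thesis
      using eQ idem unfolding complete_orthogonal_idempotents_def
      by (auto simp: E_def less_2_cases_iff Q.minus_eq Q.l_distr Q.r_distr Q.l_minus Q.r_minus
          Q.r_neg Q.l_neg)
  qed
  then obtain f where f: "complete_orthogonal_idempotents R 2 f" "\<forall>i < 2. ?J +> f i = E i"
    using sp unfolding semiperfect_def by blast
  then have f0: "f 0 \<in> carrier R" "f 0 \<otimes> f 0 = f 0" "?J +> f 0 = ?J +> e"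
    by (auto simp: complete_orthogonal_idempotents_def E_def)
  then have "f 0 \<ominus> e \<in> ?J"
    using quotient_eq_iff_same_a_r_cos[OF ideal_jacobson_radical] e(1) by simp
  with f0 show thesis using that by blast
qed


section \<open>The center is regular modulo the radical\<close>

text \<open>The case of a local ring shows the content: there \<open>f\<close> is \<open>1\<close> or \<open>0\<close>, and a central
  element is invertible in the center or lies in the radical. In general \<open>f\<close> selects the
  factor of the ring on which \<open>c\<close> is invertible. The inverse \<open>z\<close> is found in \<open>fR\<close> only; it is
  central because it inverts a central element there.\<close>
lemma (in ring) central_quasi_inverse:
  assumes sp: "semiperfect R" and T: "T_nilpotent R (jacobson_radical R)"
    and idem: "\<And>e. e \<in> carrier R \<Longrightarrow> e \<otimes> e = e \<Longrightarrow> e \<in> center R"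
    and c: "c \<in> center R"
  obtains f z where "f \<in> center R" "f \<otimes> f = f" "z \<in> center R" "c \<otimes> z = f"
    and "c \<otimes> (\<one> \<ominus> f) \<in> jacobson_radical R"
proof -
  let ?J = "jacobson_radical R"
  interpret J: ideal ?J R by (rule ideal_jacobson_radical)
  have cc: "c \<in> carrier R" using c by simp
  obtain n :: nat and x where n: "n > 0" and x: "x \<in> carrier R"
    and cx: "c [^] n \<ominus> c [^] n \<otimes> c [^] n \<otimes> x \<in> ?J"
  proof -
    \<comment> \<open>The exponent is positive so that \<open>c\<close> can be split off from \<open>c\<^sup>n\<close> at the end.\<close>
    let ?A = "{c [^] n | n :: nat. n > 0}"
    have A: "?A \<subseteq> carrier R" "?A \<noteq> {}" using cc by auto
    \<comment> \<open>Compare a minimal power of \<open>c\<close> with its square.\<close>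
    obtain a where a: "a \<in> ?A"
      and min: "\<forall>b \<in> ?A. \<forall>x \<in> carrier R. b \<ominus> a \<otimes> x \<in> ?J \<longrightarrow>
        (\<exists>y \<in> carrier R. a \<ominus> b \<otimes> y \<in> ?J)"
      using semiperfect_minimal_mod_jacobson_radical[OF sp A] .
    obtain n :: nat where n: "n > 0" "a = c [^] n" using a by blast
    have "a \<otimes> a = c [^] (n + n)" using cc n(2) by (simp add: nat_pow_mult)
    then have "a \<otimes> a \<in> ?A" using n(1) by auto
    moreover have "a \<otimes> a \<ominus> a \<otimes> a \<in> ?J" "a \<in> carrier R" using cc n(2) by simp_all
    ultimately obtain x where "x \<in> carrier R" "a \<ominus> a \<otimes> a \<otimes> x \<in> ?J"
      using min by blast
    then show thesis unfolding n(2) by (rule that[OF n(1)])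
  qed
  define d where "d = c [^] n"
  have d: "d \<in> center R" unfolding d_def using c by (rule center_pow_closed)
  then have dc: "d \<in> carrier R" by simp
  note dx = cx[folded d_def]
  have "(d \<otimes> d \<otimes> x \<ominus> d) \<otimes> x \<in> ?J"
  proof (rule J.I_r_closed[OF _ x])
    have "d \<otimes> d \<otimes> x \<ominus> d = \<ominus> (d \<ominus> d \<otimes> d \<otimes> x)"
      using dc x by (simp add: minus_eq minus_add a_comm)
    then show "d \<otimes> d \<otimes> x \<ominus> d \<in> ?J" using J.a_inv_closed[OF dx] by simp
  qed
  moreover have "(d \<otimes> d \<otimes> x \<ominus> d) \<otimes> x = (d \<otimes> x) \<otimes> (d \<otimes> x) \<ominus> d \<otimes> x"
  proof -
    have "d \<otimes> x \<otimes> (d \<otimes> x) = d \<otimes> (x \<otimes> d) \<otimes> x" using dc x by (simp add: m_assoc)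
    also have "x \<otimes> d = d \<otimes> x" using center_commutes[OF d x] by simp
    finally show ?thesis using dc x by (simp add: l_minus_distr m_assoc)
  qed
  ultimately obtain f where fc: "f \<in> carrier R" and ff: "f \<otimes> f = f" and fJ: "f \<ominus> d \<otimes> x \<in> ?J"
    using semiperfect_lift_idempotent[OF sp, of "d \<otimes> x"] dc x by auto
  have f: "f \<in> center R" using idem fc ff by blast
  \<comment> \<open>The lift agrees with \<open>dx\<close> up to the nilpotent \<open>j\<close>. On \<open>fR\<close> multiplication by \<open>dx\<close> is
    therefore multiplication by the invertible \<open>1 - j\<close>, and \<open>fxu\<close> is an inverse of \<open>d\<close> there.\<close>
  define j where "j = f \<ominus> d \<otimes> x"
  have jJ: "j \<in> ?J" and jc: "j \<in> carrier R" using fJ J.Icarr by (simp_all add: j_def)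
  obtain k :: nat where "j [^] k = \<zero>" using T_nilpotent_imp_nil[OF T jJ jc] .
  then obtain u where u: "u \<in> carrier R" "(\<one> \<ominus> j) \<otimes> u = \<one>"
    using one_minus_nilpotent_right_inverse[OF jc] by blast
  have dxf: "d \<otimes> x \<otimes> f = (\<one> \<ominus> j) \<otimes> f"
  proof -
    have "j \<otimes> f = f \<ominus> d \<otimes> x \<otimes> f" using fc ff dc x by (simp add: j_def l_minus_distr)
    then have "(\<one> \<ominus> j) \<otimes> f = f \<ominus> (f \<ominus> d \<otimes> x \<otimes> f)" using fc jc by (simp add: l_minus_distr)
    also have "\<dots> = d \<otimes> x \<otimes> f" using fc dc x by (simp add: minus_eq minus_add r_neg2)
    finally show ?thesis by simp
  qed
  define z where "z = f \<otimes> (x \<otimes> u)"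
  have zc: "z \<in> carrier R" using fc x u by (simp add: z_def)
  have fz: "f \<otimes> z = z" using fc ff x u by (simp add: z_def flip: m_assoc)
  have dz: "d \<otimes> z = f"
  proof -
    have "d \<otimes> z = d \<otimes> (f \<otimes> x) \<otimes> u" using dc fc x u by (simp add: z_def m_assoc)
    also have "\<dots> = d \<otimes> x \<otimes> f \<otimes> u"
      using center_commutes[OF f x] dc fc x by (simp add: m_assoc)
    also have "\<dots> = (\<one> \<ominus> j) \<otimes> (f \<otimes> u)" using dxf jc fc u by (simp add: m_assoc)
    also have "\<dots> = (\<one> \<ominus> j) \<otimes> u \<otimes> f"
      using center_commutes[OF f u(1)] jc fc u(1) by (simp add: m_assoc)
    finally show ?thesis using u(2) fc by simp
  qed
  \<comment> \<open>As \<open>d\<close> and \<open>f = dz\<close> are central, \<open>za = zfa = zadz = dzaz = faz = az\<close>.\<close>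
  have "z \<otimes> a = a \<otimes> z" if a: "a \<in> carrier R" for a
  proof -
    have "z \<otimes> a = z \<otimes> (f \<otimes> a)"
      using fz center_commutes[OF f zc] zc fc a by (simp flip: m_assoc)
    also have "f \<otimes> a = a \<otimes> (d \<otimes> z)" using dz center_commutes[OF f a] by simp
    also have "\<dots> = d \<otimes> (a \<otimes> z)"
      using center_commutes[OF d a] dc zc a by (simp flip: m_assoc)
    also have "z \<otimes> (d \<otimes> (a \<otimes> z)) = d \<otimes> z \<otimes> (a \<otimes> z)"
      using center_commutes[OF d zc] dc zc a by (simp flip: m_assoc)
    also have "\<dots> = a \<otimes> (f \<otimes> z)"
      using dz center_commutes[OF f a] fc zc a by (simp flip: m_assoc)
    finally show ?thesis using fz by simp
  qed
  then have z: "z \<in> center R" using zc unfolding center_def by blast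
  obtain n' where n': "n = Suc n'" using n by (cases n) auto
  show thesis
  proof (rule that[OF f ff])
    show "c [^] n' \<otimes> z \<in> center R" using center_subcring(6) center_pow_closed[OF c] z by blast
    have "c \<otimes> (c [^] n' \<otimes> z) = d \<otimes> z"
      using cc zc nat_pow_Suc2[OF cc, of n'] unfolding d_def n' by (simp add: m_assoc)
    then show "c \<otimes> (c [^] n' \<otimes> z) = f" using dz by simp
    \<comment> \<open>\<open>d(1 - f)\<close> is in \<open>J\<close>, hence so is \<open>(c(1 - f))\<^sup>n = d(1 - f)\<^sup>n\<close>. As \<open>J\<close> is nil, \<open>c(1 - f)\<close>
      is a central nilpotent.\<close>
    let ?g = "\<one> \<ominus> f"
    have g: "?g \<in> center R"
      using center_subcring(3,5,7) f by (simp add: minus_eq)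
    then have gc: "?g \<in> carrier R" by simp
    have "d \<otimes> f = d \<otimes> d \<otimes> x \<oplus> d \<otimes> j"
    proof -
      have "f = d \<otimes> x \<oplus> j" using fc dc x by (simp add: j_def minus_eq a_lcomm r_neg)
      then have "d \<otimes> f = d \<otimes> (d \<otimes> x \<oplus> j)" by simp
      also have "\<dots> = d \<otimes> d \<otimes> x \<oplus> d \<otimes> j" using dc x jc by (simp add: r_distr m_assoc)
      finally show ?thesis .
    qed
    then have "d \<otimes> ?g = (d \<ominus> d \<otimes> d \<otimes> x) \<oplus> \<ominus> (d \<otimes> j)"
      using dc fc x jc by (simp add: r_minus_distr) (simp add: minus_eq minus_add a_assoc)
    then have dg: "d \<otimes> ?g \<in> ?J"
      using dx J.a_closed J.a_inv_closed J.I_l_closed[OF jJ dc] by simp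
    have "(c \<otimes> ?g) [^] n = d \<otimes> ?g [^] n"
      unfolding d_def by (rule pow_mult_distrib[OF center_commutes[OF c gc] cc gc])
    also have "\<dots> = d \<otimes> ?g \<otimes> ?g [^] n'"
      using dc gc nat_pow_Suc2[OF gc, of n'] unfolding n' by (simp add: m_assoc)
    finally have "(c \<otimes> ?g) [^] n \<in> ?J" using J.I_r_closed[OF dg] gc by simp
    then obtain k :: nat where "((c \<otimes> ?g) [^] n) [^] k = \<zero>"
      using T_nilpotent_imp_nil[OF T] J.Icarr by metis
    then have "(c \<otimes> ?g) [^] (n * k) = \<zero>" using cc gc by (simp add: nat_pow_pow)
    moreover have "c \<otimes> ?g \<in> center R" using center_subcring(6)[OF c g] .
    ultimately show "c \<otimes> ?g \<in> ?J" by (rule central_nilpotent_in_jacobson_radical[rotated])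
  qed
qed


section \<open>Essentiality of the socle\<close>

text \<open>Let \<open>C\<close> be the center and \<open>J\<close> the radical. First \<open>r\<close> is multiplied into the annihilator
  of \<open>C \<inter> J\<close>, then the result \<open>s\<close> by a central element that is minimal modulo \<open>J\<close>. The order matters: minimality is applied to
  products with \<open>s\<close>, and elements of \<open>C \<inter> J\<close> must already act on \<open>s\<close> as zero.\<close>
lemma (in ring) multiple_generating_simple_submodule:
  assumes sp: "semiperfect R" and T: "T_nilpotent R (jacobson_radical R)"
    and idem: "\<And>e. e \<in> carrier R \<Longrightarrow> e \<otimes> e = e \<Longrightarrow> e \<in> center R"
    and r: "r \<in> carrier R" "r \<noteq> \<zero>"
  obtains c where "c \<in> center R" "r \<otimes> c \<noteq> \<zero>"
    and "simple_submodule ((\<lambda>x. r \<otimes> c \<otimes> x) ` center R) (center_ring R) (center_module R)"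
proof -
  let ?J = "jacobson_radical R"
  interpret J: ideal ?J R by (rule ideal_jacobson_radical)
  obtain b where b: "b \<in> center R" "r \<otimes> b \<noteq> \<zero>"
    and ann: "\<And>m. m \<in> center R \<inter> ?J \<Longrightarrow> r \<otimes> b \<otimes> m = \<zero>"
    using T_nilpotent_annihilated_multiple[OF T r] by blast
  define s where "s = r \<otimes> b"
  have s: "s \<in> carrier R" "s \<noteq> \<zero>" and sann: "\<And>m. m \<in> center R \<inter> ?J \<Longrightarrow> s \<otimes> m = \<zero>"
    using r(1) b ann by (simp_all add: s_def)
  let ?A = "{c \<in> center R. s \<otimes> c \<noteq> \<zero>}"
  have "\<one> \<in> ?A" using s center_subcring(3) by simp
  then have A: "?A \<subseteq> carrier R" "?A \<noteq> {}" by auto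
  obtain a where aA: "a \<in> ?A"
    and min: "\<forall>b \<in> ?A. \<forall>x \<in> carrier R. b \<ominus> a \<otimes> x \<in> ?J \<longrightarrow>
        (\<exists>y \<in> carrier R. a \<ominus> b \<otimes> y \<in> ?J)"
    using semiperfect_minimal_mod_jacobson_radical[OF sp A] .
  from aA have a: "a \<in> center R" "s \<otimes> a \<noteq> \<zero>" and ac: "a \<in> carrier R" by auto
  have generates: "\<exists>t \<in> center R. s \<otimes> a = s \<otimes> (a \<otimes> d) \<otimes> t"
    if d: "d \<in> center R" "s \<otimes> (a \<otimes> d) \<noteq> \<zero>" for d
  proof -
    have dc: "d \<in> carrier R" using d by simp
    have ad: "a \<otimes> d \<in> center R" using center_subcring(6) a d by blast
    then have adc: "a \<otimes> d \<in> carrier R" by simp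
    obtain f z where f: "f \<in> center R" and ff: "f \<otimes> f = f"
      and z: "z \<in> center R" and adz: "a \<otimes> d \<otimes> z = f"
      and adf: "a \<otimes> d \<otimes> (\<one> \<ominus> f) \<in> ?J"
      using central_quasi_inverse[OF sp T idem ad] .
    have fc: "f \<in> carrier R" and zc: "z \<in> carrier R" using f z by simp_all
    have g: "\<one> \<ominus> f \<in> center R"
      using center_subcring(3,5,7) f by (simp add: minus_eq)
    then have gc: "\<one> \<ominus> f \<in> carrier R" by simp
    have sf: "s \<otimes> f \<noteq> \<zero>"
    proof
      assume "s \<otimes> f = \<zero>"
      then have "s \<otimes> (a \<otimes> d) \<otimes> f = \<zero>"
        using center_commutes[OF f adc] s(1) adc fc by (metis m_assoc l_null)
      moreover have "s \<otimes> (a \<otimes> d \<otimes> (\<one> \<ominus> f)) = \<zero>"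
        using sann adf center_subcring(6)[OF ad g] by blast
      then have "s \<otimes> (a \<otimes> d) \<ominus> s \<otimes> (a \<otimes> d) \<otimes> f = \<zero>"
        using r_minus_distr[OF adc one_closed fc]
          r_minus_distr[OF s(1) adc m_closed[OF adc fc]] m_assoc[OF s(1) adc fc] adc by simp
      ultimately show False using d(2) s(1) adc by (simp add: minus_eq)
    qed
    \<comment> \<open>\<open>f = adz\<close> lies in \<open>aR\<close>, so by minimality \<open>fR + J\<close> contains \<open>a\<close>.\<close>
    have "f \<ominus> a \<otimes> (d \<otimes> z) \<in> ?J"
      using adz ac dc zc fc by (simp add: m_assoc)
    then obtain y where y: "y \<in> carrier R" "a \<ominus> f \<otimes> y \<in> ?J"
      using min f sf m_closed[OF dc zc] by blast
    have fg: "f \<otimes> (\<one> \<ominus> f) = \<zero>" using ff fc by (simp add: r_minus_distr)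
    have "f \<otimes> y \<otimes> (\<one> \<ominus> f) = f \<otimes> (\<one> \<ominus> f) \<otimes> y"
      using center_commutes[OF g y(1)] fc gc y(1) by (simp add: m_assoc)
    then have "(a \<ominus> f \<otimes> y) \<otimes> (\<one> \<ominus> f) = a \<otimes> (\<one> \<ominus> f)"
      using fg ac fc gc y(1) l_minus_distr[OF gc ac, of "f \<otimes> y"] by (simp add: minus_eq[of _ \<zero>])
    then have "a \<otimes> (\<one> \<ominus> f) \<in> center R \<inter> ?J"
      using J.I_r_closed[OF y(2) gc] center_subcring(6)[OF a(1) g] by simp
    then have "s \<otimes> (a \<otimes> (\<one> \<ominus> f)) = \<zero>" by (rule sann)
    then have "s \<otimes> a \<ominus> s \<otimes> (a \<otimes> f) = \<zero>" using s(1) ac fc by (simp add: r_minus_distr)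
    then have "s \<otimes> a = s \<otimes> (a \<otimes> f)" using s(1) ac fc by simp
    also have "a \<otimes> f = a \<otimes> d \<otimes> (z \<otimes> a)"
    proof -
      have "a \<otimes> f = f \<otimes> a" using center_commutes[OF a(1) fc] .
      also have "\<dots> = a \<otimes> d \<otimes> (z \<otimes> a)" using adz[symmetric] adc zc ac by (simp add: m_assoc)
      finally show ?thesis .
    qed
    also have "s \<otimes> (a \<otimes> d \<otimes> (z \<otimes> a)) = s \<otimes> (a \<otimes> d) \<otimes> (z \<otimes> a)"
      using s(1) adc zc ac by (simp add: m_assoc)
    finally show ?thesis using center_subcring(6)[OF z a(1)] by blast
  qed
  have "b \<otimes> a \<in> center R" using center_subcring(6) b a by blast
  moreover have rba: "r \<otimes> (b \<otimes> a) = s \<otimes> a" using r(1) b(1) ac by (simp add: s_def m_assoc)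
  moreover have "simple_submodule ((\<lambda>x. s \<otimes> a \<otimes> x) ` center R) (center_ring R) (center_module R)"
    (is "simple_submodule ?S _ _")
    unfolding simple_submodule_def
  proof (intro conjI allI impI)
    have sac: "s \<otimes> a \<in> carrier R" using s(1) ac by simp
    show "submodule ?S (center_ring R) (center_module R)" by (rule submodule_cyclic[OF sac])
    have "s \<otimes> a \<otimes> \<one> \<in> ?S" using center_subcring(3) by blast
    then show "?S \<noteq> {\<zero>\<^bsub>center_module R\<^esub>}" using a(2) sac by (auto simp: center_module_def)
    fix L assume "submodule L (center_ring R) (center_module R) \<and> L \<subseteq> ?S"
    then have L: "additive_subgroup L R" "\<And>x c. x \<in> L \<Longrightarrow> c \<in> center R \<Longrightarrow> x \<otimes> c \<in> L"
      and sub: "L \<subseteq> ?S" unfolding submodule_center_module_iff by auto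
    have "?S \<subseteq> L" if nz: "L \<noteq> {\<zero>}"
    proof -
      obtain l where l: "l \<in> L" "l \<noteq> \<zero>" using nz additive_subgroup.zero_closed[OF L(1)] by blast
      then obtain d where d: "d \<in> center R" "l = s \<otimes> a \<otimes> d" using sub by blast
      then have ld: "l = s \<otimes> (a \<otimes> d)" using s(1) ac by (simp add: m_assoc)
      then obtain t where t: "t \<in> center R" "s \<otimes> a = l \<otimes> t"
        using generates[OF d(1)] l(2) by blast
      have "s \<otimes> a \<in> L" unfolding t(2) by (rule L(2)[OF l(1) t(1)])
      then show ?thesis using L(2) by blast
    qed
    then show "L = {\<zero>\<^bsub>center_module R\<^esub>} \<or> L = ?S"
      using sub by (auto simp: center_module_def)
  qed
  ultimately show thesis using that[of "b \<otimes> a"] a(2) by simp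
qed

lemma (in ring) centrally_essential_if_socle_central:
  assumes sp: "semiperfect R" and T: "T_nilpotent R (jacobson_radical R)"
    and idem: "\<And>e. e \<in> carrier R \<Longrightarrow> e \<otimes> e = e \<Longrightarrow> e \<in> center R"
    and soc: "socle (center_ring R) (center_module R) \<subseteq> center R"
  shows "centrally_essential R"
  unfolding centrally_essential_iff
proof (intro ballI impI)
  fix r assume r: "r \<in> carrier R" "r \<noteq> \<zero>"
  obtain c where c: "c \<in> center R" "r \<otimes> c \<noteq> \<zero>"
    and simple: "simple_submodule ((\<lambda>x. r \<otimes> c \<otimes> x) ` center R) (center_ring R) (center_module R)"
    using multiple_generating_simple_submodule[OF sp T idem r] .
  have "r \<otimes> c = r \<otimes> c \<otimes> \<one>" using r(1) c(1) by simp
  then have "r \<otimes> c \<in> (\<lambda>x. r \<otimes> c \<otimes> x) ` center R" using center_subcring(3) by blast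
  then have "r \<otimes> c \<in> center R" using simple_submodule_subset_socle[OF simple] soc by blast
  then show "\<exists>c \<in> center R. r \<otimes> c \<in> center R \<and> r \<otimes> c \<noteq> \<zero>" using c by blast
qed

theorem theorem3:
  fixes R :: "('a, 'b) ring_scheme" (structure)
  assumes "ring R"
    and "right_perfect R \<or> left_perfect R"
  shows "centrally_essential R \<longleftrightarrow>
    socle (center_ring R) (center_module R) \<subseteq> center R \<and>
    (\<forall>e \<in> carrier R. e \<otimes> e = e \<longrightarrow> e \<in> center R)"
proof -
  interpret ring R by (rule assms(1))
  have perfect: "semiperfect R" "T_nilpotent R (jacobson_radical R)"
    using assms(2) by (auto simp: right_perfect_def left_perfect_def T_nilpotent_def)
  show ?thesis
  proof (intro iffI conjI ballI impI)
    assume ess: "centrally_essential R"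
    show "socle (center_ring R) (center_module R) \<subseteq> center R"
      by (intro socle_subset_center simple_submodule_central[OF ess])
    show "e \<in> center R" if "e \<in> carrier R" "e \<otimes> e = e" for e
      by (rule centrally_essential_imp_idempotent_central[OF ess that])
  next
    assume "socle (center_ring R) (center_module R) \<subseteq> center R \<and>
      (\<forall>e \<in> carrier R. e \<otimes> e = e \<longrightarrow> e \<in> center R)"
    then show "centrally_essential R"
      by (intro centrally_essential_if_socle_central[OF perfect]) auto
  qed
qed

end
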